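(* The limiting zeta function $\zeta$ (defined in the context) can be rewritten in the following various ways: (a) Hypergeometric series: $\displaystyle \zeta(2s)=\pi\;{}_4F_3\Big(\tfrac14,\tfrac34,-s,s;\tfrac12,\tfrac12,1;-4\Big)$, that is, $$\zeta(2s,z)=\pi\sum_{n=0}^{\infty}\frac{(1/4)_n\,(3/4)_n\,(-s)_n\,(s)_n}{(1/2)_n\,(1/2)_n\,(1)_n}\,\frac{z^n}{n!}$$ analytically continued to $z=-4$. (b) Fourier transform: a $\cos$-transform of a smooth measure on an interval, $$\zeta(it)=\int_0^{\log(2+\sqrt5)}\cos(ty)\,\sqrt{\frac{\cosh(y)\coth(y)}{2-\sinh(y)}}\;dy.$$ (c) Original expression: $$\zeta(it)=\int_0^1 2\cos\Big(t\log\big((\sqrt{4\sin^4(\pi x)+1}+2\sin^2(\pi x))^2\big)\Big)\,dx.$$ (d) Simplest integral: $$\zeta(it)=\int_0^1\frac{2\cos\big(2t\log(\sqrt{4v^2+1}+2v)\big)}{\pi\sqrt{1-v}\,\sqrt v}\,dv.$$ (e) Abelian integral: if $a=2+\sqrt5$, then $$\zeta(s)=\int_1^a\frac{(z^2+1)\,z^{-1-s}\,(1+z^{2s})}{2\sqrt{(1+z)(1-z)(z-a)(z+1/a)}}\,dz=\int_1^a F(z)\,dz,$$ where $F(z)$ denotes the integrand.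
   Context: The connection Laplacian $L$ of a finite abstract simplicial complex $G$ (a finite set of non-empty finite sets closed under taking non-empty subsets) is the matrix indexed by the elements of $G$ with $L(x,y)=1$ if $x\cap y\neq\emptyset$ and $L(x,y)=0$ otherwise. For the circular graph $C_n$, viewed as a one-dimensional complex with $n$ vertices and $n$ edges, the normalized connection zeta function is $\zeta_{C_n}(s)=\sum_k\lambda_k^{s}$, the sum being over the eigenvalues $\lambda_k$ of $L^2$ (by the symmetry of the spectrum of $L^2$ under $\lambda\to1/\lambda$, the sign of the exponent does not matter). It satisfies $\zeta_{C_n}(s)=\sum_{k=1}^n Z(k/n,s)$ with $$Z(x,s)=\big(f_+(4\sin^2(\pi x))^2\big)^s+\big(f_-(4\sin^2(\pi x))^2\big)^s,$$ where $f_\pm(y)=(y\pm\sqrt{y^2+4})/2$ are the solutions $x$ of $x-1/x=y$. The limiting zeta function is the limit of $\zeta_{C_n}(s)/n$ as $n\to\infty$, namely $\int_0^1 Z(x,s)\,dx$, an entire function of $s$; it is the function called $\zeta$ in the claim. Here $i$ is the imaginary unit, $(a)_0=1$ and $(a)_n=a(a+1)\cdots(a+n-1)$ is the Pochhammer symbol (raising factorial), and ${}_4F_3$ is the generalized hypergeometric function, whose series in $z$ has radius of convergence $1$ and is understood at $z=-4$ by analytic continuation.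
   Formalization: The limiting zeta function has ζ(0)=2, while the right-hand sides of (a), (b), (e) equal π at 0; so in (a), (b), (e) the function ζ(s) on the left is replaced by (π/2)ζ(s/2), while (c) and (d) are for ζ as defined. *)

theory Defs
  imports
    "HOL-Complex_Analysis.Complex_Analysis"
    "Jordan_Normal_Form.Char_Poly"
begin

definition finite_simplicial_complex :: "'a set set \<Rightarrow> bool" where
  "finite_simplicial_complex G \<longleftrightarrow>
     finite G \<and> (\<forall>x\<in>G. finite x \<and> x \<noteq> {}) \<and> (\<forall>x\<in>G. \<forall>y. y \<subseteq> x \<and> y \<noteq> {} \<longrightarrow> y \<in> G)"

(* A complex is presented by a repetition-free list xs of its simplices; another ordering of
   the list conjugates the matrix by a permutation and leaves the spectrum unchanged. *)
definition connection_laplacian :: "'a set list \<Rightarrow> complex mat" where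
  "connection_laplacian xs =
     mat (length xs) (length xs) (\<lambda>(i, j). if xs ! i \<inter> xs ! j \<noteq> {} then 1 else 0)"

(* Eigenvalues of the square of L, counted with algebraic multiplicity.  This matrix is real
   symmetric and, L being unimodular, positive definite: powr is only used at positive reals. *)
definition connection_zeta :: "'a set list \<Rightarrow> complex \<Rightarrow> complex" where
  "connection_zeta xs s =
     (\<Sum>l\<in>#proots (char_poly (connection_laplacian xs * connection_laplacian xs)). l powr s)"

(* The cycle graph on {0..<n} as a one-dimensional complex; meaningful for n \<ge> 3. *)
definition circular_complex :: "nat \<Rightarrow> nat set list" where
  "circular_complex n = map (\<lambda>k. {k}) [0..<n] @ map (\<lambda>k. {k, Suc k mod n}) [0..<n]"

definition limiting_zeta :: "complex \<Rightarrow> complex" where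
  "limiting_zeta s = lim (\<lambda>n. connection_zeta (circular_complex n) s / of_nat n)"

(* Two normalizations of the limiting zeta function are in use.  The hypergeometric value, the
   cos-transform and the Abelian integral are those of (pi/2) * limiting_zeta (s/2): the
   exponent is that of the absolute values of the eigenvalues of L itself instead of those of
   its square, and the total mass at s = 0 is pi instead of 2.  They do not hold for
   limiting_zeta, whose value at 0 is 2. *)
definition rescaled_limiting_zeta :: "complex \<Rightarrow> complex" where
  "rescaled_limiting_zeta s = complex_of_real (pi / 2) * limiting_zeta (s / 2)"

definition coth :: "real \<Rightarrow> real" where
  "coth y = cosh y / sinh y"

definition hypergeo_term :: "complex list \<Rightarrow> complex list \<Rightarrow> complex \<Rightarrow> nat \<Rightarrow> complex" where
  "hypergeo_term as bs z n =
     (\<Prod>a\<leftarrow>as. pochhammer a n) / (\<Prod>b\<leftarrow>bs. pochhammer b n) * (z ^ n / fact n)"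

definition slit_plane :: "complex set" where
  "slit_plane = - complex_of_real ` {1..}"

(* Analytic continuation from the unit disc to the plane cut along [1, \<infinity>), for
   length as = Suc (length bs); hypergeo_eqI shows that it does not depend on a choice. *)
definition hypergeo :: "complex list \<Rightarrow> complex list \<Rightarrow> complex \<Rightarrow> complex" where
  "hypergeo as bs =
     (SOME F. F holomorphic_on slit_plane \<and> (\<forall>z\<in>ball 0 1. hypergeo_term as bs z sums F z))"

lemma circular_complex_correct:
  assumes "n \<ge> 3"
  shows "distinct (circular_complex n)"
    and "length (circular_complex n) = 2 * n"
    and "finite_simplicial_complex (set (circular_complex n))"
proof -
  have ne: "k \<noteq> Suc k mod n" if "k < n" for k
    using that assms by (auto simp: mod_Suc)
  have inj: "k = l" if "k < n" "l < n" "{k, Suc k mod n} = {l, Suc l mod n}" for k l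
    using that assms by (auto simp: doubleton_eq_iff mod_Suc split: if_splits)
  have "inj_on (\<lambda>k. {k, Suc k mod n}) {0..<n}"
    by (rule inj_onI) (auto intro: inj)
  moreover have "{k} \<noteq> {l, Suc l mod n}" if "l < n" for k l
    using ne[OF that] by (metis insertCI singletonD)
  ultimately show "distinct (circular_complex n)"
    by (auto simp: circular_complex_def distinct_map)
  show "length (circular_complex n) = 2 * n"
    by (simp add: circular_complex_def)
  let ?V = "(\<lambda>k. {k}) ` {0..<n}" and ?E = "(\<lambda>k. {k, Suc k mod n}) ` {0..<n}"
  have set: "set (circular_complex n) = ?V \<union> ?E"
    by (simp add: circular_complex_def)
  have "y \<in> ?V \<union> ?E" if x: "x \<in> ?V \<union> ?E" and y: "y \<subseteq> x" "y \<noteq> {}" for x y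
    using x
  proof
    assume "x \<in> ?V"
    with y have "y = x" by auto
    with x show ?thesis by simp
  next
    assume "x \<in> ?E"
    then obtain k where k: "k < n" "x = {k, Suc k mod n}" by auto
    with y have "y = {k} \<or> y = {Suc k mod n} \<or> y = x" by auto
    moreover have "Suc k mod n < n" using assms by simp
    ultimately show ?thesis using k x by auto
  qed
  thus "finite_simplicial_complex (set (circular_complex n))"
    unfolding finite_simplicial_complex_def set by (intro conjI) (simp, blast, blast)
qed

lemma open_slit_plane: "open slit_plane"
  by (simp add: slit_plane_def open_Compl closed_slot_right)

lemma unit_ball_subset_slit_plane: "ball 0 1 \<subseteq> slit_plane"
  by (auto simp: slit_plane_def)

lemma connected_slit_plane: "connected slit_plane"
  unfolding slit_plane_def by (rule starlike_imp_connected[OF starlike_slotted_complex_plane_right])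

lemma hypergeo_eqI:
  assumes "F holomorphic_on slit_plane"
    and "\<And>z. norm z < 1 \<Longrightarrow> hypergeo_term as bs z sums F z"
    and "z \<in> slit_plane"
  shows "hypergeo as bs z = F z"
proof -
  let ?P = "\<lambda>F. F holomorphic_on slit_plane \<and> (\<forall>z\<in>ball 0 1. hypergeo_term as bs z sums F z)"
  have "?P F" using assms by auto
  hence "?P (hypergeo as bs)" unfolding hypergeo_def by (rule someI[where P = ?P])
  hence hol: "hypergeo as bs holomorphic_on slit_plane"
    and sums: "hypergeo_term as bs w sums hypergeo as bs w" if "w \<in> ball 0 1" for w
    using that by blast+
  have "hypergeo as bs w = F w" if "w \<in> ball 0 1" for w
    using sums[OF that] assms(2)[of w] that sums_unique2 by auto
  thus ?thesis
    using analytic_continuation_open[of "ball 0 1" slit_plane "hypergeo as bs" F z]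
      hol[of 0] assms(1,3) open_slit_plane connected_slit_plane unit_ball_subset_slit_plane
    by auto
qed

end

theory Submission
  imports Defs
begin

text \<open>
  All five expressions are one integral in disguise. Put
  \<open>J s = \<integral>\<^sub>0\<^sup>1 2 cosh (2 s arsinh (2 sin\<^sup>2 (\<pi> x))) dx\<close>, called \<open>zeta_integral\<close> below.

  Rotational symmetry diagonalises the connection Laplacian of the cycle. If the vertex \<open>j\<close> sits at
  position \<open>2 j\<close> and the edge from \<open>j\<close> to \<open>j + 1\<close> at position \<open>2 j + 1\<close> of a circle of length
  \<open>2 n\<close>, a plane wave of angle \<open>\<theta> = \<pi> k / n\<close> with one amplitude on the vertices and one on the edges
  is mapped to such a wave, and the amplitudes transform by the matrix with rows \<open>(1, c)\<close> and
  \<open>(c, c\<^sup>2 - 1)\<close>, \<open>c = 2 cos \<theta>\<close> (\<open>connection_laplacian_circular_mode\<close>). Its determinant is \<open>- 1\<close>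
  and its trace is \<open>c\<^sup>2\<close>, so its eigenvalues are \<open>e\<^sup>a\<close> and \<open>- e\<^sup>-\<^sup>a\<close> with \<open>2 sinh a = c\<^sup>2\<close>. The \<open>2 n\<close>
  eigenvectors obtained in this way are pairwise orthogonal, so they give the characteristic
  polynomial of \<open>L\<^sup>2\<close> with multiplicities, and \<open>connection_zeta\<close> divided by \<open>n\<close> becomes a Riemann sum.
  Its limit is \<open>J\<close> with \<open>cos\<close> in place of \<open>sin\<close>, which has the same value
  (\<open>limiting_zeta_eq_integral\<close>).

  The integral representations are the substitutions \<open>sin\<^sup>2 (\<pi> x) = v\<close>, \<open>v = (sinh y) / 2\<close> and
  \<open>y = ln z\<close>. As \<open>sin\<^sup>2 (\<pi> x)\<close> has the arcsine distribution, a single lemma,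
  \<open>has_integral_arcsine_substitution\<close>, covers all of them.

  For the hypergeometric value, \<open>cosh (2 s arsinh r) = cos (2 s arcsin u)\<close> with \<open>u = \<i> r\<close>. This is an even
  function of \<open>u\<close> satisfying \<open>(1 - u\<^sup>2) g'' - u g' + 4 s\<^sup>2 g = 0\<close>, which determines its Taylor
  coefficients: as a function of \<open>w = u\<^sup>2\<close> it is the Gauss series with parameters \<open>- s, s; 1/2\<close>, and
  evenness continues it to the plane cut along \<open>[1, \<infinity>)\<close>. Averaging \<open>w = z sin\<^sup>4 (\<pi> x)\<close> over \<open>x\<close>
  multiplies the \<open>n\<close>-th coefficient by the moment \<open>\<integral>\<^sub>0\<^sup>1 sin\<^sup>4\<^sup>n (\<pi> x) dx\<close>, which contributes the
  parameters \<open>1/4, 3/4; 1/2, 1\<close>. The averaged function is still holomorphic on the cut plane, so it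
  is the analytic continuation of the series; at \<open>z = - 4\<close> one has \<open>u = 2 \<i> sin\<^sup>2 (\<pi> x)\<close>, which is the
  integrand of \<open>J s / 2\<close>.
\<close>

section \<open>Substitution against the arcsine distribution\<close>

lemma integral_even_about_half:
  fixes f :: "real \<Rightarrow> 'a::euclidean_space"
  assumes cont: "continuous_on {0..1} f" and sym: "\<And>x. f (1 - x) = f x"
  shows "integral {0..1} f = 2 *\<^sub>R integral {0..1/2} f"
proof -
  have left: "(f has_integral integral {0..1/2} f) {0..1/2}"
    by (intro integrable_integral integrable_continuous_real continuous_on_subset[OF cont]) auto
  have "((\<lambda>x. f (- x + 1)) has_integral integral {0..1/2} f) {1/2..1}"
    using has_integral_affinity[of f _ 0 "1/2" "-1" 1] left
    by (simp add: image_affinity_atLeastAtMost)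
  hence "(f has_integral integral {0..1/2} f) {1/2..1}"
    by (simp add: sym)
  from has_integral_combine[OF _ _ left this] show ?thesis
    by (simp add: integral_unique scaleR_2)
qed

text \<open>
  The density \<open>1 / (\<pi> sqrt (v (1 - v)))\<close> is that of \<open>sin\<^sup>2 (\<pi> x)\<close> for uniform \<open>x\<close>. The integrand on
  the left is usually unbounded at the endpoints, while the right-hand side is an integral of a
  continuous function. So the substitution is performed from the right-hand side, through
  \<open>x = arcsin (sqrt (\<phi> y)) / \<pi>\<close>, which stays continuous up to the endpoints and covers half of the
  period.
\<close>

lemma has_integral_arcsine_substitution:
  fixes h :: "real \<Rightarrow> complex" and \<phi> \<phi>' :: "real \<Rightarrow> real"
  assumes h: "continuous_on {0..1} h" and ab: "a < b"
    and \<phi>: "continuous_on {a..b} \<phi>" "\<phi> a = 0" "\<phi> b = 1"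
    and range: "\<And>x. a < x \<Longrightarrow> x < b \<Longrightarrow> 0 < \<phi> x \<and> \<phi> x < 1"
    and deriv: "\<And>x. a < x \<Longrightarrow> x < b \<Longrightarrow> (\<phi> has_real_derivative \<phi>' x) (at x)"
  shows "((\<lambda>x. complex_of_real (\<phi>' x / (pi * sqrt (1 - \<phi> x) * sqrt (\<phi> x))) * h (\<phi> x))
           has_integral integral {0..1} (\<lambda>x. h (sin (pi * x) ^ 2))) {a..b}"
proof -
  let ?f = "\<lambda>x. h (sin (pi * x) ^ 2)" and ?g = "\<lambda>x. arcsin (sqrt (\<phi> x)) / pi"
  let ?g' = "\<lambda>x. \<phi>' x / (2 * pi * sqrt (1 - \<phi> x) * sqrt (\<phi> x))"
  have range': "0 \<le> \<phi> x \<and> \<phi> x \<le> 1" if "x \<in> {a..b}" for x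
    using range[of x] that \<phi> by (cases "x = a"; cases "x = b") auto
  have f: "continuous_on A ?f" for A
    by (intro continuous_on_compose2[OF h] continuous_intros) (auto simp: abs_square_le_1)
  have "((\<lambda>x. ?g' x *\<^sub>R ?f (?g x)) has_integral integral {?g a..?g b} ?f - integral {?g b..?g a} ?f) {a..b}"
  proof (rule has_integral_substitution_general[where s = "{a, b}" and c = 0 and d = "1/2"])
    have "arcsin (sqrt (\<phi> x)) \<le> pi / 2 \<and> 0 \<le> arcsin (sqrt (\<phi> x))" if "x \<in> {a..b}" for x
    proof -
      have sq: "0 \<le> sqrt (\<phi> x)" "sqrt (\<phi> x) \<le> 1" using range'[OF that] by auto
      hence "- 1 \<le> sqrt (\<phi> x)" by linarith
      from arcsin_ubound[OF this sq(2)] arcsin_le_arcsin[of 0 "sqrt (\<phi> x)"]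
      show ?thesis using sq by simp
    qed
    thus "?g ` {a..b} \<subseteq> {0..1/2}" by (auto simp: field_simps)
    show "continuous_on {a..b} ?g"
      using range' by (intro continuous_intros \<phi>) (auto intro: order_trans[of _ 0])
    fix x assume "x \<in> {a..b} - {a, b}"
    hence x: "a < x" "x < b" by auto
    have sq: "0 < sqrt (\<phi> x)" "sqrt (\<phi> x) < 1" using range[OF x] by auto
    have "((\<lambda>x. sqrt (\<phi> x)) has_real_derivative inverse (sqrt (\<phi> x)) / 2 * \<phi>' x) (at x)"
      using range[OF x] by (intro DERIV_chain2[OF DERIV_real_sqrt deriv[OF x]]) auto
    note dsqrt = this
    have "- 1 < sqrt (\<phi> x)" using sq(1) by linarith
    note darcsin = DERIV_arcsin[OF this sq(2)]
    have "(?g has_real_derivative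
        inverse (sqrt (1 - (sqrt (\<phi> x))\<^sup>2)) * (inverse (sqrt (\<phi> x)) / 2 * \<phi>' x) / pi) (at x within {a..b})"
      using DERIV_chain2[where f = arcsin and g = "\<lambda>x. sqrt (\<phi> x)", OF darcsin dsqrt]
      by (rule has_field_derivative_at_within[OF DERIV_cdivide])
    also have "inverse (sqrt (1 - (sqrt (\<phi> x))\<^sup>2)) * (inverse (sqrt (\<phi> x)) / 2 * \<phi>' x) / pi = ?g' x"
      using range[OF x] by (simp add: inverse_eq_divide)
    finally show "(?g has_real_derivative ?g' x) (at x within {a..b})" .
  qed (use ab f in simp_all)
  from has_integral_cmul[OF this, of 2]
  have "((\<lambda>x. 2 *\<^sub>R (?g' x *\<^sub>R ?f (?g x))) has_integral 2 *\<^sub>R integral {0..1/2} ?f) {a..b}"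
    using \<phi> by simp
  moreover have "integral {0..1} ?f = 2 *\<^sub>R integral {0..1/2} ?f"
    by (rule integral_even_about_half[OF f]) (simp add: sin_diff algebra_simps)
  ultimately have "((\<lambda>x. 2 *\<^sub>R (?g' x *\<^sub>R ?f (?g x))) has_integral integral {0..1} ?f) {a..b}"
    by simp
  thus ?thesis
  proof (rule has_integral_cong[THEN iffD1, rotated])
    fix x assume "x \<in> {a..b}"
    thus "2 *\<^sub>R (?g' x *\<^sub>R ?f (?g x)) =
        complex_of_real (\<phi>' x / (pi * sqrt (1 - \<phi> x) * sqrt (\<phi> x))) * h (\<phi> x)"
      using range'[of x] order_trans[of "-1" 0 "sqrt (\<phi> x)"] by (simp add: scaleR_conv_of_real)
  qed
qed

section \<open>The integral behind the limiting zeta function\<close>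

text \<open>
  With \<open>y = 4 v\<close>, the number \<open>arsinh (2 v)\<close> is the logarithm of \<open>f\<^sub>+ y = (y + sqrt (y\<^sup>2 + 4)) / 2\<close>,
  and \<open>f\<^sub>- y = - 1 / f\<^sub>+ y\<close>; hence the kernel is the sum of the powers \<open>(f\<^sub>+\<^sup>2)\<^sup>s\<close> and \<open>(f\<^sub>-\<^sup>2)\<^sup>s\<close>.
\<close>

definition zeta_kernel :: "complex \<Rightarrow> real \<Rightarrow> complex" where
  "zeta_kernel s v = 2 * cosh (2 * s * complex_of_real (arsinh (2 * v)))"

definition zeta_integral :: "complex \<Rightarrow> complex" where
  "zeta_integral s = integral {0..1} (\<lambda>x. zeta_kernel s (sin (pi * x) ^ 2))"

lemma continuous_on_zeta_kernel: "continuous_on A (zeta_kernel s)"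
  unfolding zeta_kernel_def by (intro continuous_intros)

lemma cosh_i_times: "cosh (\<i> * z) = cos z" for z :: complex
  by (simp add: cosh_conv_cos)

lemma zeta_integral_sin:
  "((\<lambda>x. 2 * cos (t * complex_of_real
              (ln ((sqrt (4 * sin (pi * x) ^ 4 + 1) + 2 * sin (pi * x) ^ 2) ^ 2))))
        has_integral zeta_integral (\<i> * t)) {0..1}"
proof -
  have "zeta_kernel (\<i> * t) (sin (pi * x) ^ 2) = 2 * cos (t * complex_of_real
              (ln ((sqrt (4 * sin (pi * x) ^ 4 + 1) + 2 * sin (pi * x) ^ 2) ^ 2)))" for x
  proof -
    have "0 < sqrt (4 * sin (pi * x) ^ 4 + 1) + 2 * sin (pi * x) ^ 2"
      by (intro add_pos_nonneg) (auto simp: add_pos_nonneg add_nonneg_pos)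
    thus ?thesis
      unfolding zeta_kernel_def cosh_i_times[symmetric]
      by (simp add: arsinh_real_def ln_realpow power_mult_distrib algebra_simps flip: power_mult)
  qed
  moreover have "((\<lambda>x. zeta_kernel (\<i> * t) (sin (pi * x) ^ 2)) has_integral zeta_integral (\<i> * t)) {0..1}"
    unfolding zeta_integral_def zeta_kernel_def
    by (intro integrable_integral integrable_continuous_real continuous_intros)
  ultimately show ?thesis by simp
qed

lemma zeta_integral_arcsine:
  "((\<lambda>v. 2 * cos (2 * t * complex_of_real (ln (sqrt (4 * v ^ 2 + 1) + 2 * v))) /
              complex_of_real (pi * sqrt (1 - v) * sqrt v))
        has_integral zeta_integral (\<i> * t)) {0..1}"
proof -
  have "((\<lambda>v. complex_of_real (1 / (pi * sqrt (1 - v) * sqrt v)) * zeta_kernel (\<i> * t) v)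
          has_integral zeta_integral (\<i> * t)) {0..1}"
    unfolding zeta_integral_def
    by (rule has_integral_arcsine_substitution[OF continuous_on_zeta_kernel]) auto
  thus ?thesis
    unfolding zeta_kernel_def arsinh_real_def
    by (simp add: cosh_i_times[symmetric] power_mult_distrib algebra_simps)
qed

lemma zeta_integral_cos_transform:
  "((\<lambda>y. cos (t * complex_of_real y) *
              complex_of_real (sqrt (cosh y * coth y / (2 - sinh y))))
        has_integral complex_of_real (pi / 2) * zeta_integral (\<i> * t / 2)) {0..ln (2 + sqrt 5)}"
    (is "(_ has_integral _) {0..?b}")
proof -
  have b: "?b = arsinh 2" by (simp add: arsinh_real_def)
  have "((\<lambda>y. complex_of_real (cosh y / 2 / (pi * sqrt (1 - sinh y / 2) * sqrt (sinh y / 2)))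
            * zeta_kernel (\<i> * t / 2) (sinh y / 2))
          has_integral zeta_integral (\<i> * t / 2)) {0..arsinh 2}"
    unfolding zeta_integral_def
  proof (rule has_integral_arcsine_substitution[OF continuous_on_zeta_kernel])
    fix x :: real assume x: "0 < x" "x < arsinh 2"
    hence "sinh x < sinh (arsinh (2::real))" by (subst sinh_real_less_iff)
    thus "0 < sinh x / 2 \<and> sinh x / 2 < 1" using x by simp
    show "((\<lambda>x. sinh x / 2) has_real_derivative cosh x / 2) (at x)"
      by (auto intro!: derivative_eq_intros)
  qed (auto intro!: continuous_intros)
  from has_integral_mult_right[OF this, of "complex_of_real (pi / 2)"]
  show ?thesis unfolding b
  proof (rule has_integral_spike_finite[of "{0, arsinh 2}", rotated 2])
    fix y assume "y \<in> {0..arsinh 2} - {0, arsinh (2::real)}"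
    hence y: "0 < y" "y < arsinh 2" by auto
    hence "sinh y < sinh (arsinh (2::real))" by (subst sinh_real_less_iff)
    hence S: "sinh y > 0" "sinh y < 2" using y by simp_all
    \<comment> \<open>The root in the claim is the arcsine density at \<open>(sinh y) / 2\<close> times the derivative of
      \<open>(sinh y) / 2\<close>, up to the factor \<open>\<pi>\<close>; at the two endpoints both sides carry default values.\<close>
    have "sqrt (cosh y * coth y / (2 - sinh y)) = cosh y / (2 * (sqrt (1 - sinh y / 2) * sqrt (sinh y / 2)))"
    proof (rule real_sqrt_unique)
      show "(cosh y / (2 * (sqrt (1 - sinh y / 2) * sqrt (sinh y / 2))))\<^sup>2 = cosh y * coth y / (2 - sinh y)"
        using S by (simp add: power_divide power_mult_distrib coth_def field_simps power2_eq_square)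
    qed (use S in auto)
    thus "cos (t * complex_of_real y) * complex_of_real (sqrt (cosh y * coth y / (2 - sinh y)))
        = complex_of_real (pi / 2) *
           (complex_of_real (cosh y / 2 / (pi * sqrt (1 - sinh y / 2) * sqrt (sinh y / 2)))
            * zeta_kernel (\<i> * t / 2) (sinh y / 2))"
      using S by (simp add: zeta_kernel_def arsinh_sinh_real cosh_i_times[symmetric] mult.assoc)
  qed auto
qed

text \<open>
  Here \<open>\<phi> z = (z - 1 / z) / 4\<close> is \<open>sinh (ln z) / 2\<close>, and since \<open>a\<close> and \<open>- 1 / a\<close> are the roots of
  \<open>z\<^sup>2 - 4 z - 1\<close>, the quartic under the square root is \<open>(4 z)\<^sup>2 \<phi> z (1 - \<phi> z)\<close>.
\<close>

lemma zeta_integral_abelian: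
  defines "a \<equiv> 2 + sqrt 5"
  shows "((\<lambda>z. (complex_of_real z ^ 2 + 1) * complex_of_real z powr (-1 - s) *
               (1 + complex_of_real z powr (2 * s)) /
              (2 * complex_of_real (sqrt ((1 + z) * (1 - z) * (z - a) * (z + 1 / a)))))
        has_integral complex_of_real (pi / 2) * zeta_integral (s / 2)) {1..a}"
proof -
  have sqrt5: "sqrt 5 > 2" by (rule real_less_rsqrt) simp
  hence a: "a > 1" unfolding a_def by simp
  have a_inv: "1 / a = sqrt 5 - 2" using sqrt5 unfolding a_def by (simp add: field_simps)
  have a_quad: "(z - a) * (z + 1 / a) = z\<^sup>2 - 4 * z - 1" for z
    unfolding a_inv by (simp add: a_def algebra_simps power2_eq_square)
  let ?\<phi> = "\<lambda>z::real. (z - 1 / z) / 4"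
  have range: "0 < ?\<phi> z \<and> ?\<phi> z < 1" if z: "1 < z" "z < a" for z
  proof -
    have "1 / z < z" using z by (simp add: field_simps less_1_mult)
    moreover have "(z - a) * (z + 1 / a) < 0" using z a by (auto intro!: mult_neg_pos add_pos_pos)
    hence "z - 1 / z < 4" unfolding a_quad using z by (simp add: field_simps power2_eq_square)
    ultimately show ?thesis by simp
  qed
  have "((\<lambda>z. complex_of_real ((1 + 1 / z\<^sup>2) / 4 / (pi * sqrt (1 - ?\<phi> z) * sqrt (?\<phi> z)))
            * zeta_kernel (s / 2) (?\<phi> z))
          has_integral zeta_integral (s / 2)) {1..a}"
    unfolding zeta_integral_def
  proof (rule has_integral_arcsine_substitution[OF continuous_on_zeta_kernel])
    show "?\<phi> a = 1" using a_inv by (simp add: a_def)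
    fix z assume z: "1 < z" "z < a"
    show "(?\<phi> has_real_derivative (1 + 1 / z\<^sup>2) / 4) (at z)"
      using z by (auto intro!: derivative_eq_intros simp: power2_eq_square)
  qed (use a range in \<open>auto intro!: continuous_intros\<close>)
  from has_integral_mult_right[OF this, of "complex_of_real (pi / 2)"]
  show ?thesis
  proof (rule has_integral_spike_finite[of "{1, a}", rotated 2])
    fix z assume "z \<in> {1..a} - {1, a}"
    hence z: "1 < z" "z < a" by auto
    let ?Q = "(1 + z) * (1 - z) * (z - a) * (z + 1 / a)"
    note \<phi> = range[OF z]
    have Q: "?Q = (4 * z)\<^sup>2 * ((1 - ?\<phi> z) * ?\<phi> z)"
      unfolding mult.assoc[of _ "z - a"] a_quad using z by (simp add: field_simps power2_eq_square)
    have sqrtQ: "sqrt ?Q = 4 * z * (sqrt (1 - ?\<phi> z) * sqrt (?\<phi> z))"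
      unfolding Q real_sqrt_mult real_sqrt_abs using z by simp
    have "2 * ?\<phi> z = sinh (ln z)" using z by (simp add: sinh_ln_real divide_simps)
    hence arsinh: "arsinh (2 * ?\<phi> z) = ln z" by (simp only: arsinh_sinh_real)
    have pw: "complex_of_real z powr w = exp (w * complex_of_real (ln z))" for w
      using z by (simp add: powr_def Ln_of_real)
    have "exp (complex_of_real (ln z)) = complex_of_real z" using z by (simp add: exp_of_real)
    hence "complex_of_real z powr (- 1 - s) * (1 + complex_of_real z powr (2 * s)) * complex_of_real z
        = exp (- (s * complex_of_real (ln z))) + exp (s * complex_of_real (ln z))"
      unfolding pw using z by (simp add: left_diff_distrib exp_diff exp_minus field_simps flip: exp_add)
    also have "\<dots> = zeta_kernel (s / 2) (?\<phi> z)"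
      unfolding zeta_kernel_def arsinh by (simp add: cosh_field_def)
    finally have num: "complex_of_real z powr (- 1 - s) * (1 + complex_of_real z powr (2 * s))
        = zeta_kernel (s / 2) (?\<phi> z) / complex_of_real z"
      using z by (simp add: nonzero_eq_divide_eq)
    define r where "r = sqrt (1 - ?\<phi> z) * sqrt (?\<phi> z)"
    have r: "r > 0" unfolding r_def using \<phi> by simp
    show "(complex_of_real z ^ 2 + 1) * complex_of_real z powr (-1 - s) *
               (1 + complex_of_real z powr (2 * s)) / (2 * complex_of_real (sqrt ?Q))
       = complex_of_real (pi / 2) *
          (complex_of_real ((1 + 1 / z\<^sup>2) / 4 / (pi * sqrt (1 - ?\<phi> z) * sqrt (?\<phi> z)))
            * zeta_kernel (s / 2) (?\<phi> z))"
      unfolding sqrtQ unfolding mult.assoc num unfolding r_def[symmetric] using z r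
      by (simp add: field_simps power2_eq_square)
  qed auto
qed

section \<open>Riemann sums\<close>

text \<open>
  By uniform continuity, on each subinterval the increment of the antiderivative differs from its
  summand by at most \<open>e / (2 n)\<close>; these increments telescope to the integral.
\<close>

lemma riemann_sum_tendsto_integral:
  fixes f :: "real \<Rightarrow> 'a::euclidean_space"
  assumes cont: "continuous_on {0..1} f"
  shows "(\<lambda>n. (\<Sum>k<n. f (real k / real n)) /\<^sub>R real n) \<longlonglongrightarrow> integral {0..1} f"
proof (rule LIMSEQ_I)
  fix e :: real assume e: "e > 0"
  have "uniformly_continuous_on {0..1} f"
    by (intro compact_uniformly_continuous cont) auto
  then obtain d where d: "d > 0"
    "\<And>x y. x \<in> {0..1} \<Longrightarrow> y \<in> {0..1} \<Longrightarrow> dist y x < d \<Longrightarrow> dist (f y) (f x) < e / 2"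
    unfolding uniformly_continuous_on_def using e by (metis half_gt_zero)
  obtain N where N: "1 / real N < d" "N > 0"
    using reals_Archimedean[OF d(1)] by (metis inverse_eq_divide zero_less_Suc)
  have "norm ((\<Sum>k<n. f (real k / real n)) /\<^sub>R real n - integral {0..1} f) < e" if n: "n \<ge> N" for n
  proof -
    have n0: "n > 0" using N n by simp
    have "1 / real n \<le> 1 / real N" using N n by (simp add: field_simps)
    with N have small: "1 / real n < d" by simp
    define F where "F x = integral {0..x} f" for x
    have sub: "norm (F (real (Suc k) / real n) - F (real k / real n) - f (real k / real n) /\<^sub>R real n)
        \<le> e / 2 * (1 / real n)" if k: "k < n" for k
    proof -
      let ?a = "real k / real n" and ?b = "real (Suc k) / real n"
      have ab: "0 \<le> ?a" "?a \<le> ?b" "?b \<le> 1" "?b - ?a = 1 / real n"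
        using k by (auto simp: field_simps)
      have int: "f integrable_on {u..v}" if "0 \<le> u" "v \<le> 1" for u v
        using that by (intro integrable_continuous_real continuous_on_subset[OF cont]) auto
      have "F ?b = F ?a + integral {?a..?b} f"
        unfolding F_def using ab int[of 0 ?b] by (intro Henstock_Kurzweil_Integration.integral_combine[symmetric]) auto
      hence "F ?b - F ?a - f ?a /\<^sub>R real n = integral {?a..?b} (\<lambda>x. f x - f ?a)"
        using ab int[of ?a ?b] by (subst Henstock_Kurzweil_Integration.integral_diff) (auto simp: inverse_eq_divide)
      also have "norm \<dots> \<le> e / 2 * (?b - ?a)"
      proof (rule integral_bound)
        show "continuous_on {?a..?b} (\<lambda>x. f x - f ?a)"
          using ab by (intro continuous_intros continuous_on_subset[OF cont]) auto
        fix x assume x: "x \<in> {?a..?b}"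
        hence "dist x ?a < d" using ab small unfolding dist_real_def atLeastAtMost_iff by linarith
        moreover have "x \<in> {0..1}" using x ab unfolding atLeastAtMost_iff by linarith
        ultimately show "norm (f x - f ?a) \<le> e / 2"
          using d(2)[of ?a x] ab by (auto simp: dist_norm)
      qed (use ab in auto)
      finally show ?thesis using ab(4) by simp
    qed
    have "integral {0..1} f - (\<Sum>k<n. f (real k / real n)) /\<^sub>R real n
        = (\<Sum>k<n. F (real (Suc k) / real n) - F (real k / real n) - f (real k / real n) /\<^sub>R real n)"
      using sum_lessThan_telescope[of "\<lambda>k. F (real k / real n)" n] n0
      by (simp add: sum_subtractf F_def scaleR_sum_right)
    also have "norm \<dots> \<le> (\<Sum>k<n. e / 2 * (1 / real n))"
      by (intro order_trans[OF norm_sum] sum_mono sub) auto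
    also have "\<dots> < e" using n0 e by simp
    finally show ?thesis by (simp add: norm_minus_commute)
  qed
  thus "\<exists>no. \<forall>n\<ge>no. norm ((\<Sum>k<n. f (real k / real n)) /\<^sub>R real n - integral {0..1} f) < e" by blast
qed

section \<open>The spectrum of the cycle\<close>

text \<open>
  The matrix \<open>P\<close> with columns \<open>v i\<close> has orthogonal nonzero columns, so its conjugate transpose with
  rows divided by their squared lengths is an inverse, and \<open>P\<close> conjugates \<open>A\<close> into a diagonal
  matrix. The eigenvalues may coincide, so distinctness of eigenvalues could not replace
  orthogonality.
\<close>

lemma char_poly_eq_orthogonal_eigenvectors:
  fixes A :: "complex mat" and v :: "nat \<Rightarrow> nat \<Rightarrow> complex"
  assumes A: "A \<in> carrier_mat N N"
    and eig: "\<And>i r. i < N \<Longrightarrow> r < N \<Longrightarrow> (\<Sum>q<N. A $$ (r, q) * v i q) = ev i * v i r"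
    and orth: "\<And>i j. i < N \<Longrightarrow> j < N \<Longrightarrow> i \<noteq> j \<Longrightarrow> (\<Sum>q<N. cnj (v i q) * v j q) = 0"
    and nz: "\<And>i. i < N \<Longrightarrow> \<exists>q<N. v i q \<noteq> 0"
  shows "char_poly A = (\<Prod>i\<leftarrow>[0..<N]. [:- ev i, 1:])"
proof -
  define c where "c i = (\<Sum>q<N. cnj (v i q) * v i q)" for i
  have c: "c i \<noteq> 0" if "i < N" for i
  proof -
    obtain q where q: "q < N" "v i q \<noteq> 0" using nz \<open>i < N\<close> by blast
    have "0 < (\<Sum>q<N. (cmod (v i q))\<^sup>2)"
      by (rule sum_pos2[of _ q]) (use q in auto)
    moreover have "c i = complex_of_real (\<Sum>q<N. (cmod (v i q))\<^sup>2)"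
      unfolding c_def of_real_sum
      by (intro sum.cong refl) (subst complex_norm_square, rule mult.commute)
    ultimately show ?thesis by (metis less_irrefl of_real_eq_0_iff)
  qed
  define P where "P = mat N N (\<lambda>(r, i). v i r)"
  define Q where "Q = mat N N (\<lambda>(i, r). cnj (v i r) / c i)"
  define D where "D = mat_diag N ev"
  have carrier: "P \<in> carrier_mat N N" "Q \<in> carrier_mat N N" "D \<in> carrier_mat N N"
    by (simp_all add: P_def Q_def D_def)
  have QP: "Q * P = 1\<^sub>m N"
  proof (rule eq_matI)
    fix i j assume "i < dim_row (1\<^sub>m N :: complex mat)" "j < dim_col (1\<^sub>m N :: complex mat)"
    hence ij: "i < N" "j < N" by auto
    have "(Q * P) $$ (i, j) = (\<Sum>q<N. cnj (v i q) * v j q) / c i"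
      using ij by (simp add: P_def Q_def scalar_prod_def sum_divide_distrib lessThan_atLeast0)
    also have "\<dots> = (1\<^sub>m N) $$ (i, j)"
      using ij c orth[of i j] by (cases "i = j") (auto simp: c_def)
    finally show "(Q * P) $$ (i, j) = (1\<^sub>m N) $$ (i, j)" .
  qed (auto simp: P_def Q_def)
  have PQ: "P * Q = 1\<^sub>m N"
    by (rule mat_mult_left_right_inverse[OF carrier(2,1) QP])
  have AP: "A * P = P * D"
  proof (rule eq_matI)
    fix r i assume "r < dim_row (P * D)" "i < dim_col (P * D)"
    hence ri: "r < N" "i < N" using carrier by auto
    have "(A * P) $$ (r, i) = (\<Sum>q<N. A $$ (r, q) * v i q)"
      using ri A by (simp add: P_def scalar_prod_def lessThan_atLeast0)
    also have "\<dots> = (P * D) $$ (r, i)"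
      using ri carrier unfolding D_def
      by (subst mat_diag_mult_right[of _ N]) (auto simp: eig P_def)
    finally show "(A * P) $$ (r, i) = (P * D) $$ (r, i)" .
  qed (use A carrier in auto)
  have "A = A * (P * Q)" using A PQ by simp
  also have "\<dots> = P * D * Q" using A carrier AP by (metis assoc_mult_mat)
  finally have "similar_mat A D"
    using A carrier PQ QP by (intro similar_matI[of _ _ P Q N]) auto
  hence "char_poly A = char_poly D" by (rule char_poly_similar)
  also have "\<dots> = (\<Prod>a\<leftarrow>diag_mat D. [:- a, 1:])"
    by (rule char_poly_upper_triangular[OF carrier(3)]) (auto simp: D_def mat_diag_def)
  also have "diag_mat D = map ev [0..<N]"
    by (auto simp: diag_mat_def D_def mat_diag_def)
  finally show ?thesis by (simp add: o_def)
qed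

lemma sum_proots_linear_factors:
  "(\<Sum>l\<in>#proots (\<Prod>i\<leftarrow>[0..<N]. [:- ev i, 1:]). f l) = (\<Sum>i<N. f (ev i :: complex))"
proof (induction N)
  case (Suc N)
  have "(\<Prod>i\<leftarrow>[0..<N]. [:- ev i, 1:]) \<noteq> 0" by (auto simp: prod_list_zero_iff)
  thus ?case using Suc by (simp add: proots_mult add.commute del: mult_pCons_right)
qed auto

lemma sum_lessThan_double: "(\<Sum>q<2 * n. f q) = (\<Sum>q<n. f q) + (\<Sum>q<n. f (n + q))"
  for f :: "nat \<Rightarrow> 'a::comm_monoid_add"
proof -
  have "{..<2 * n} = {..<n} \<union> {0 + n..<n + n}" by auto
  moreover have "(\<Sum>q\<in>{0 + n..<n + n}. f q) = (\<Sum>q<n. f (n + q))"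
    unfolding sum.shift_bounds_nat_ivl by (simp add: add.commute lessThan_atLeast0)
  ultimately show ?thesis by (simp add: sum.union_disjoint ivl_disj_int)
qed

lemma sum_indicator_set:
  fixes f :: "nat \<Rightarrow> complex"
  assumes "{q. q < n \<and> P q} = S"
  shows "(\<Sum>q<n. (if P q then 1 else 0) * f q) = sum f S"
proof -
  have "(\<Sum>q<n. (if P q then 1 else 0) * f q) = (\<Sum>q | q < n \<and> P q. f q)"
    by (intro sum.mono_neutral_cong_right) auto
  thus ?thesis using assms by simp
qed

definition circular_angle :: "nat \<Rightarrow> nat \<Rightarrow> real" where
  "circular_angle n k = pi * (real k / real n)"

text \<open>
  A plane wave of angle \<open>\<theta>\<close> per half step, with amplitudes \<open>w = (vertices, edges)\<close>. Edges occupy the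
  odd positions, the midpoints of their endpoints; this phase makes the action on the amplitudes
  a real symmetric matrix.
\<close>

definition circular_mode :: "nat \<Rightarrow> real \<Rightarrow> real \<times> real \<Rightarrow> nat \<Rightarrow> complex" where
  "circular_mode n \<theta> w q =
     (if q < n then complex_of_real (fst w) * cis (\<theta> * (2 * real q))
      else complex_of_real (snd w) * cis (\<theta> * (2 * real (q - n) + 1)))"

lemma circular_complex_nth:
  "q < n \<Longrightarrow> circular_complex n ! q = {q}"
  "q < n \<Longrightarrow> circular_complex n ! (n + q) = {q, Suc q mod n}"
  by (auto simp: circular_complex_def nth_append)

definition cyclic_pred :: "nat \<Rightarrow> nat \<Rightarrow> nat" where
  "cyclic_pred n j = (if j = 0 then n - 1 else j - 1)"

text \<open>
  A vertex meets itself and the two edges at positions \<open>\<plusminus>1\<close>; an edge meets itself, its two endpoints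
  at positions \<open>\<plusminus>1\<close> and the two adjacent edges at positions \<open>\<plusminus>2\<close>. On the wave \<open>E\<close> the neighbours at
  distance 1 contribute the factor \<open>c\<close>, those at distance 2 the factor \<open>c\<^sup>2 - 2\<close>. For \<open>n \<ge> 3\<close> these
  neighbours are distinct, and the wave has period \<open>2 n\<close>, so wrapping around is harmless.
\<close>

lemma connection_laplacian_circular_mode:
  fixes w :: "real \<times> real" and n k :: nat
  assumes n: "n \<ge> 3" and r: "r < 2 * n"
  defines "\<theta> \<equiv> circular_angle n k"
  defines "c \<equiv> 2 * cos \<theta>"
  shows "(\<Sum>q<2 * n. connection_laplacian (circular_complex n) $$ (r, q) * circular_mode n \<theta> w q)
       = circular_mode n \<theta> (fst w + c * snd w, c * fst w + (c\<^sup>2 - 1) * snd w) r"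
proof -
  define E where "E x = cis (\<theta> * x)" for x :: real
  have period: "E (x + 2 * real n) = E x" for x
  proof -
    have "\<theta> * (x + 2 * real n) = \<theta> * x + 2 * pi * real k"
      using n by (simp add: \<theta>_def circular_angle_def field_simps)
    thus ?thesis unfolding E_def by (simp add: cis_mult[symmetric] cis_multiple_2pi)
  qed
  have nbr: "E (x + 1) + E (x - 1) = complex_of_real c * E x" for x
    by (simp add: E_def c_def complex_eq_iff cos_add cos_diff sin_add sin_diff algebra_simps)
  have nbr2: "E (x + 2) + E (x - 2) = complex_of_real (c\<^sup>2 - 2) * E x" for x
  proof -
    have "E (x + 2) + E (x - 2) = complex_of_real c * (E (x + 1) + E (x - 1)) - 2 * E x"
      unfolding distrib_left nbr[symmetric] by (simp add: algebra_simps)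
    thus ?thesis unfolding nbr by (simp add: algebra_simps power2_eq_square)
  qed
  have Esuc: "E (2 * real (Suc j mod n) + d) = E (2 * real j + (d + 2))" if "j < n" for j d
    using that n period[of d] by (cases "Suc j = n") (auto simp: algebra_simps)
  have Epred: "E (2 * real (cyclic_pred n j) + d) = E (2 * real j + (d - 2))" if "j < n" for j d
    using that n period[of "d - 2"] by (auto simp: cyclic_pred_def algebra_simps of_nat_diff)
  have edges_at: "{q. q < n \<and> {j} \<inter> {q, Suc q mod n} \<noteq> {}} = {j, cyclic_pred n j}"
    and ends: "{q. q < n \<and> {j, Suc j mod n} \<inter> {q} \<noteq> {}} = {j, Suc j mod n}"
    and adj: "{q. q < n \<and> {j, Suc j mod n} \<inter> {q, Suc q mod n} \<noteq> {}} = {j, Suc j mod n, cyclic_pred n j}"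
    and dist: "j \<noteq> Suc j mod n" "j \<noteq> cyclic_pred n j" "Suc j mod n \<noteq> cyclic_pred n j"
    if "j < n" for j
    using that n by (auto simp: cyclic_pred_def mod_Suc split: if_splits)
  have len: "length (circular_complex n) = 2 * n" by (simp add: circular_complex_def)
  let ?L = "connection_laplacian (circular_complex n)"
  have L: "?L $$ (p, q) = (if circular_complex n ! p \<inter> circular_complex n ! q \<noteq> {} then 1 else 0)"
    if "p < 2 * n" "q < 2 * n" for p q
    using that by (simp add: connection_laplacian_def len)
  let ?u = "complex_of_real (fst w)" and ?v = "complex_of_real (snd w)"
  have split: "(\<Sum>q<2 * n. ?L $$ (r, q) * circular_mode n \<theta> w q)
     = (\<Sum>q<n. (if circular_complex n ! r \<inter> {q} \<noteq> {} then 1 else 0) * (?u * E (2 * real q + 0)))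
     + (\<Sum>q<n. (if circular_complex n ! r \<inter> {q, Suc q mod n} \<noteq> {} then 1 else 0) * (?v * E (2 * real q + 1)))"
    unfolding sum_lessThan_double using r
    by (intro arg_cong2[of _ _ _ _ "(+)"] sum.cong refl)
       (simp_all add: L circular_complex_nth circular_mode_def E_def)
  show ?thesis
  proof (cases "r < n")
    case True
    have "{q. q < n \<and> {r} \<inter> {q} \<noteq> {}} = {r}" using True by auto
    note self = sum_indicator_set[OF this]
    have "(\<Sum>q<2 * n. ?L $$ (r, q) * circular_mode n \<theta> w q)
        = ?u * E (2 * real r) + ?v * (E (2 * real r + 1) + E (2 * real r - 1))"
      unfolding split circular_complex_nth(1)[OF True] self sum_indicator_set[OF edges_at[OF True]]
      using dist(2)[OF True] Epred[OF True, of 1] by (simp add: distrib_left)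
    thus ?thesis unfolding nbr using True
      by (simp add: circular_mode_def E_def algebra_simps)
  next
    case False
    define j where "j = r - n"
    have j: "j < n" "r = n + j" using False r by (auto simp: j_def)
    note [simp] = dist[OF j(1)]
    have "(\<Sum>q<2 * n. ?L $$ (r, q) * circular_mode n \<theta> w q)
        = ?u * (E (2 * real j) + E (2 * real j + 2)) 
          + ?v * (E (2 * real j + 1) + (E (2 * real j + 3) + E (2 * real j - 1)))"
      unfolding split unfolding j(2) circular_complex_nth(2)[OF j(1)]
        sum_indicator_set[OF ends[OF j(1)]] sum_indicator_set[OF adj[OF j(1)]]
      using Epred[OF j(1), of 1] Esuc[OF j(1), of 0] Esuc[OF j(1), of 1]
      by (simp add: algebra_simps)
    also have "E (2 * real j) + E (2 * real j + 2) = complex_of_real c * E (2 * real j + 1)"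
      using nbr[of "2 * real j + 1"] by (simp add: algebra_simps)
    also have "E (2 * real j + 3) + E (2 * real j - 1) = complex_of_real (c\<^sup>2 - 2) * E (2 * real j + 1)"
      using nbr2[of "2 * real j + 1"] by (simp add: algebra_simps)
    finally show ?thesis using j
      by (simp add: circular_mode_def E_def algebra_simps)
  qed
qed

text \<open>
  The inner product factors through a geometric sum over \<open>n\<close>-th roots of unity, which vanishes
  for distinct frequencies; for equal frequencies the amplitudes decide.
\<close>

lemma circular_mode_inner:
  assumes "k < n" "k' < n" "k \<noteq> k' \<or> fst w * fst w' + snd w * snd w' = 0"
  shows "(\<Sum>q<2 * n. cnj (circular_mode n (circular_angle n k) w q)
           * circular_mode n (circular_angle n k') w' q) = 0"
proof -
  let ?d = "circular_angle n k' - circular_angle n k"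
  let ?S = "\<Sum>q<n. cis (2 * ?d) ^ q"
  have "(\<Sum>q<2 * n. cnj (circular_mode n (circular_angle n k) w q)
           * circular_mode n (circular_angle n k') w' q)
      = (complex_of_real (fst w * fst w') + complex_of_real (snd w * snd w') * cis ?d) * ?S"
    unfolding sum_lessThan_double sum_distrib_left sum.distrib[symmetric]
    by (intro sum.cong refl)
       (simp add: circular_mode_def cis_cnj cis_mult Complex.DeMoivre algebra_simps)
  also have "\<dots> = 0"
  proof (cases "k = k'")
    case True
    thus ?thesis using assms(3) by (simp flip: of_real_mult of_real_add)
  next
    case False
    have root: "cis (2 * circular_angle n j) = cis (2 * pi * real j / real n)" for j
      by (simp add: circular_angle_def mult.assoc)
    have "inj_on (\<lambda>j. cis (2 * pi * real j / real n)) {..<n}"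
      using Complex.bij_betw_roots_unity[of n] assms(1) by (auto simp: bij_betw_def)
    hence "cis (2 * circular_angle n k') \<noteq> cis (2 * circular_angle n k)"
      using False assms(1,2) unfolding root inj_on_def by auto
    hence "cis (2 * ?d) \<noteq> 1"
      by (simp add: right_diff_distrib cis_divide[symmetric])
    moreover have "cis (2 * ?d) ^ n = 1"
    proof -
      have "real n * (2 * ?d) = 2 * pi * real_of_int (int k' - int k)"
        using assms(1) by (simp add: circular_angle_def field_simps)
      thus ?thesis unfolding Complex.DeMoivre by (simp only: cis_multiple_2pi Ints_of_int)
    qed
    ultimately have "?S = 0" by (simp add: geometric_sum)
    thus ?thesis by simp
  qed
  finally show ?thesis .
qed

lemma eigenvector_square:
  fixes A :: "complex mat"
  assumes A: "A \<in> carrier_mat N N"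
    and eig: "\<And>r. r < N \<Longrightarrow> (\<Sum>q<N. A $$ (r, q) * v q) = \<mu> * v r" and r: "r < N"
  shows "(\<Sum>q<N. (A * A) $$ (r, q) * v q) = \<mu>\<^sup>2 * v r"
proof -
  have "(\<Sum>q<N. (A * A) $$ (r, q) * v q) = (\<Sum>q<N. \<Sum>p<N. A $$ (r, p) * (A $$ (p, q) * v q))"
    using A r by (intro sum.cong refl) 
      (simp add: scalar_prod_def sum_distrib_right lessThan_atLeast0 mult.assoc)
  also have "\<dots> = (\<Sum>p<N. A $$ (r, p) * (\<Sum>q<N. A $$ (p, q) * v q))"
    unfolding sum_distrib_left by (rule sum.swap)
  also have "\<dots> = \<mu> * (\<Sum>p<N. A $$ (r, p) * v p)"
    unfolding sum_distrib_left[of \<mu>] by (intro sum.cong refl) (simp add: eig)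
  finally show ?thesis using r by (simp add: eig power2_eq_square)
qed

lemma connection_zeta_circular:
  assumes n: "n \<ge> 3"
  shows "connection_zeta (circular_complex n) s
       = (\<Sum>k<n. zeta_kernel s (cos (circular_angle n k) ^ 2))"
proof -
  let ?L = "connection_laplacian (circular_complex n)"
  define a where "a k = arsinh (2 * cos (circular_angle n k) ^ 2)" for k
  define c where "c k = 2 * cos (circular_angle n k)" for k
  \<comment> \<open>The eigenvector for \<open>e\<^sup>a\<close> is \<open>(1 + e\<^sup>-\<^sup>a, c)\<close>, and the one for \<open>- e\<^sup>-\<^sup>a\<close> is taken perpendicular to it.
    The other obvious choices, such as \<open>(c, e\<^sup>a - 1)\<close>, vanish when \<open>c = 0\<close>, that is for
    \<open>\<theta> = \<pi> / 2\<close>; here one amplitude is always positive.\<close>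
  define w where "w i = (if i < n then (1 + exp (- a (i mod n)), c (i mod n))
                          else (- c (i mod n), 1 + exp (- a (i mod n))))" for i
  define \<mu> where "\<mu> i = (if i < n then exp (a (i mod n)) else - exp (- a (i mod n)))" for i
  define v where "v i = circular_mode n (circular_angle n (i mod n)) (w i)" for i
  have L: "?L \<in> carrier_mat (2 * n) (2 * n)"
    by (simp add: connection_laplacian_def circular_complex_def flip: mult_2)
  have c2: "(c k)\<^sup>2 = exp (a k) - exp (- a k)" for k
    using sinh_arsinh_real[of "2 * cos (circular_angle n k) ^ 2"]
    by (simp add: sinh_field_def c_def a_def power_mult_distrib)
  have inv: "exp (a k) * exp (- a k) = 1" for k by (simp flip: exp_add)
  have w_eig: "fst (w i) + c (i mod n) * snd (w i) = \<mu> i * fst (w i)"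
    "c (i mod n) * fst (w i) + ((c (i mod n))\<^sup>2 - 1) * snd (w i) = \<mu> i * snd (w i)" for i
    by (simp_all add: inv w_def \<mu>_def c2 c2[unfolded power2_eq_square] algebra_simps
        flip: mult.assoc power2_eq_square)
  have "(\<Sum>q<2 * n. ?L $$ (r, q) * v i q) = complex_of_real (\<mu> i) * v i r" if "r < 2 * n" for i r
  proof -
    have "(\<Sum>q<2 * n. ?L $$ (r, q) * v i q)
        = circular_mode n (circular_angle n (i mod n))
            (fst (w i) + c (i mod n) * snd (w i), c (i mod n) * fst (w i) + ((c (i mod n))\<^sup>2 - 1) * snd (w i)) r"
      unfolding v_def c_def by (rule connection_laplacian_circular_mode[OF n that])
    also have "\<dots> = complex_of_real (\<mu> i) * v i r"
      unfolding w_eig v_def by (simp add: circular_mode_def)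
    finally show ?thesis .
  qed
  note sq_eig = eigenvector_square[OF L this]
  have "char_poly (?L * ?L) = (\<Prod>i\<leftarrow>[0..<2 * n]. [:- (complex_of_real (\<mu> i))\<^sup>2, 1:])"
  proof (rule char_poly_eq_orthogonal_eigenvectors)
    show "?L * ?L \<in> carrier_mat (2 * n) (2 * n)" using L by simp
    show "(\<Sum>q<2 * n. (?L * ?L) $$ (r, q) * v i q) = (complex_of_real (\<mu> i))\<^sup>2 * v i r"
      if "r < 2 * n" for i r by (rule sq_eig) (use that in auto)
    fix i assume i: "i < 2 * n"
    have "1 + exp (- a (i mod n)) > 0" by (intro add_pos_pos) auto
    hence "v i (if i < n then 0 else n) \<noteq> 0"
      using n by (auto simp: v_def circular_mode_def w_def simp flip: of_real_add)
    thus "\<exists>q<2 * n. v i q \<noteq> 0" using n by (intro exI[of _ "if i < n then 0 else n"]) auto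
    fix j assume j: "j < 2 * n" "i \<noteq> j"
    have "i mod n \<noteq> j mod n \<or> fst (w i) * fst (w j) + snd (w i) * snd (w j) = 0"
    proof (cases "i mod n = j mod n")
      case True
      hence "(i < n) \<noteq> (j < n)" using i j by (auto simp: mod_if split: if_splits)
      thus ?thesis using True by (auto simp: w_def)
    qed simp
    thus "(\<Sum>q<2 * n. cnj (v i q) * v j q) = 0"
      unfolding v_def using n by (intro circular_mode_inner) auto
  qed
  hence "connection_zeta (circular_complex n) s = (\<Sum>i<2 * n. ((complex_of_real (\<mu> i))\<^sup>2) powr s)"
    unfolding connection_zeta_def by (simp add: sum_proots_linear_factors)
  also have "\<dots> = (\<Sum>k<n. ((complex_of_real (exp (a k)))\<^sup>2) powr s + ((complex_of_real (- exp (- a k)))\<^sup>2) powr s)"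
    unfolding sum_lessThan_double sum.distrib[symmetric]
    by (intro sum.cong refl) (simp add: \<mu>_def)
  also have "\<dots> = (\<Sum>k<n. zeta_kernel s (cos (circular_angle n k) ^ 2))"
  proof (intro sum.cong refl)
    fix k
    have powr: "complex_of_real (exp x) powr s = exp (s * complex_of_real x)" for x
      by (simp add: powr_def Ln_of_real)
    have "(complex_of_real (exp (a k)))\<^sup>2 = complex_of_real (exp (2 * a k))"
      "(complex_of_real (- exp (- a k)))\<^sup>2 = complex_of_real (exp (- (2 * a k)))"
      by (simp_all flip: of_real_power exp_double add: exp_minus power_inverse)
    thus "((complex_of_real (exp (a k)))\<^sup>2) powr s + ((complex_of_real (- exp (- a k)))\<^sup>2) powr s
        = zeta_kernel s (cos (circular_angle n k) ^ 2)"
      by (simp only: powr) (simp add: zeta_kernel_def cosh_field_def a_def mult_ac)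
  qed
  finally show ?thesis .
qed

text \<open>
  The eigenvalues involve \<open>cos\<^sup>2 (\<pi> k / n)\<close>. For odd \<open>n\<close> these numbers are not the \<open>sin\<^sup>2 (\<pi> k / n)\<close> up to
  order, but in the limit the two integrals agree by reflection in \<open>1/4\<close>.
\<close>

lemma limiting_zeta_eq_integral: "limiting_zeta s = zeta_integral s"
proof -
  let ?f = "\<lambda>x. zeta_kernel s (cos (pi * x) ^ 2)" and ?g = "\<lambda>x. zeta_kernel s (sin (pi * x) ^ 2)"
  have cont: "continuous_on A ?f" "continuous_on A ?g" for A
    unfolding zeta_kernel_def by (intro continuous_intros)+
  have "(?g has_integral integral {0..1/2} ?g) {0..1/2}"
    by (intro integrable_integral integrable_continuous_real cont)
  from has_integral_affinity[of ?g _ 0 "1/2" "-1" "1/2"] this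
  have "((\<lambda>x. ?g (- x + 1/2)) has_integral integral {0..1/2} ?g) {0..1/2}"
    by (simp add: image_affinity_atLeastAtMost)
  moreover have "?g (- x + 1/2) = ?f x" for x
    by (simp add: sin_cos_eq algebra_simps)
  ultimately have "integral {0..1/2} ?f = integral {0..1/2} ?g"
    by (simp add: integral_unique)
  moreover have "integral {0..1} ?f = 2 *\<^sub>R integral {0..1/2} ?f"
    by (rule integral_even_about_half[OF cont(1)]) (simp add: cos_diff algebra_simps)
  moreover have "integral {0..1} ?g = 2 *\<^sub>R integral {0..1/2} ?g"
    by (rule integral_even_about_half[OF cont(2)]) (simp add: sin_diff algebra_simps)
  ultimately have int: "integral {0..1} ?f = zeta_integral s"
    by (simp add: zeta_integral_def)
  have "(\<lambda>n. (\<Sum>k<n. ?f (real k / real n)) /\<^sub>R real n) \<longlonglongrightarrow> zeta_integral s"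
    using riemann_sum_tendsto_integral[OF cont(1)] unfolding int .
  moreover have "eventually (\<lambda>n. (\<Sum>k<n. ?f (real k / real n)) /\<^sub>R real n
      = connection_zeta (circular_complex n) s / of_nat n) sequentially"
    using eventually_ge_at_top[of 3]
    by eventually_elim (simp add: connection_zeta_circular circular_angle_def scaleR_conv_of_real field_simps)
  ultimately have "(\<lambda>n. connection_zeta (circular_complex n) s / of_nat n) \<longlonglongrightarrow> zeta_integral s"
    by (rule Lim_transform_eventually)
  thus ?thesis unfolding limiting_zeta_def by (rule limI)
qed

section \<open>The Gauss series of a cosine of an arcsine\<close>

text \<open>
  With \<open>x = \<i> z + sqrt (1 - z\<^sup>2)\<close> one has \<open>Arcsin z = - \<i> Ln x\<close>, and \<open>z \<mapsto> - z\<close> inverts \<open>x\<close>. The logarithm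
  of the inverse is the negative logarithm because \<open>x\<close> avoids the negative axis:
  \<open>x + 1 / x = 2 sqrt (1 - z\<^sup>2)\<close> has nonnegative real part.
\<close>

lemma Arcsin_minus: "Arcsin (- z) = - Arcsin z"
proof -
  define q where "q = csqrt (1 - z\<^sup>2)"
  define x where "x = \<i> * z + q"
  have "x * (q - \<i> * z) = q\<^sup>2 + z\<^sup>2"
    by (simp add: x_def algebra_simps power2_eq_square)
  also have "q\<^sup>2 = 1 - z\<^sup>2" by (simp add: q_def)
  finally have prod: "x * (q - \<i> * z) = 1" by simp
  hence x0: "x \<noteq> 0" and inv: "q - \<i> * z = inverse x"
    by (auto simp: inverse_unique)
  have "x \<notin> \<real>\<^sub>\<le>\<^sub>0"
  proof
    assume "x \<in> \<real>\<^sub>\<le>\<^sub>0"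
    then obtain r where r: "x = complex_of_real r" "r \<le> 0" by (auto elim: nonpos_Reals_cases)
    with x0 have "r < 0" by (cases "r = 0") auto
    moreover have "complex_of_real (r + inverse r) = 2 * q"
      using inv r(1) by (simp add: x_def algebra_simps)
    hence "r + inverse r = 2 * Re q" by (metis Re_complex_of_real complex_Re_numeral mult_2 plus_complex.simps(1))
    ultimately show False
      using csqrt_principal[of "1 - z\<^sup>2", folded q_def]
      using negative_imp_inverse_negative[of r] by linarith
  qed
  hence "Ln (inverse x) = - Ln x" by (rule Ln_inverse)
  thus ?thesis
    unfolding Arcsin_def using inv by (simp add: x_def q_def)
qed

text \<open>
  An even function does not see the sign of the square root. Near \<open>w0 \<noteq> 0\<close> the branch
  \<open>csqrt (w / w0) * csqrt w0\<close> is holomorphic even if \<open>w0\<close> lies on the cut of \<open>csqrt\<close>, and it agrees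
  with \<open>csqrt w\<close> up to sign. The origin is a removable singularity.
\<close>

lemma holomorphic_on_even_csqrt:
  assumes g: "g holomorphic_on U" and U: "open U" and S: "open S"
    and even: "\<And>u. g (- u) = g u" and range: "\<And>w. w \<in> S \<Longrightarrow> csqrt w \<in> U"
  shows "(\<lambda>w. g (csqrt w)) holomorphic_on S"
proof (rule no_isolated_singularity[of _ _ "{0}"])
  have diff: "(\<lambda>w. g (csqrt w)) field_differentiable (at w0)" if w0: "w0 \<in> S" "w0 \<noteq> 0" for w0
  proof -
    let ?r = "\<lambda>w. csqrt (w / w0) * csqrt w0"
    have "g (csqrt w) = g (?r w)" for w
    proof -
      have "(csqrt w)\<^sup>2 = (?r w)\<^sup>2" using w0 by (simp add: power_mult_distrib)
      thus ?thesis unfolding power2_eq_iff by (auto simp: even)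
    qed
    moreover have "?r field_differentiable (at w0)"
      using w0 by (intro field_differentiable_mult field_differentiable_const
          field_differentiable_compose[of "\<lambda>w. w / w0" w0 csqrt, unfolded o_def]
          field_differentiable_divide field_differentiable_ident field_differentiable_at_csqrt) auto
    moreover have "g field_differentiable (at (?r w0))"
      using w0 range[OF w0(1)] g U by (simp add: holomorphic_on_imp_differentiable_at)
    ultimately show ?thesis
      using field_differentiable_compose[of ?r w0 g] by (simp add: o_def)
  qed
  show "(\<lambda>w. g (csqrt w)) holomorphic_on S - {0}"
    using diff by (auto simp: holomorphic_on_def intro: field_differentiable_at_within)
  have "isCont (\<lambda>w. g (csqrt w)) w" if w: "w \<in> S" for w
  proof (cases "w = 0")
    case True
    have "((\<lambda>w. norm (csqrt w)) \<longlongrightarrow> 0) (at 0)"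
      unfolding norm_csqrt by (auto intro!: tendsto_eq_intros)
    hence "(csqrt \<longlongrightarrow> 0) (at 0)" by (rule tendsto_norm_zero_cancel)
    hence "isCont csqrt 0" by (simp add: isCont_def)
    moreover have "isCont g (csqrt 0)"
      using range[OF w] g U True by (metis continuous_on_eq_continuous_at holomorphic_on_imp_continuous_on)
    ultimately show ?thesis unfolding True by (rule isCont_o2)
  next
    case False
    thus ?thesis using diff w by (intro field_differentiable_imp_continuous_at) auto
  qed
  thus "continuous_on S (\<lambda>w. g (csqrt w))"
    by (intro continuous_at_imp_continuous_on) auto
qed (use S in auto)

definition cos_arcsin :: "complex \<Rightarrow> complex \<Rightarrow> complex" where
  "cos_arcsin s u = cos (2 * s * Arcsin u)"

definition arcsin_domain :: "complex set" where
  "arcsin_domain = {u. Im u = 0 \<longrightarrow> \<bar>Re u\<bar> < 1}"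

lemma open_arcsin_domain: "open arcsin_domain"
proof -
  have "arcsin_domain = {u. Im u \<noteq> 0} \<union> {u. \<bar>Re u\<bar> < 1}" by (auto simp: arcsin_domain_def)
  also have "open \<dots>" by (intro open_Un open_Collect_neq open_Collect_less continuous_intros)
  finally show ?thesis .
qed

lemma ball_subset_arcsin_domain: "ball 0 1 \<subseteq> arcsin_domain"
proof
  fix u :: complex assume "u \<in> ball 0 1"
  hence "\<bar>Re u\<bar> < 1" using abs_Re_le_cmod[of u] by (auto intro: le_less_trans)
  thus "u \<in> arcsin_domain" by (simp add: arcsin_domain_def)
qed

lemma holomorphic_on_cos_arcsin: "cos_arcsin s holomorphic_on arcsin_domain"
  unfolding cos_arcsin_def
  by (intro holomorphic_intros holomorphic_on_Arcsin) (auto simp: arcsin_domain_def)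

lemma cos_Arcsin_squared: "(cos (Arcsin u))\<^sup>2 = 1 - u\<^sup>2"
  by (simp add: cos_squared_eq)

text \<open>
  With \<open>u = sin \<alpha>\<close> this is the equation \<open>g'' = - 4 s\<^sup>2 g\<close> for \<open>g = cos (2 s \<alpha>)\<close>. In the variable \<open>u\<close> it is
  regular at \<open>0\<close>, whereas the hypergeometric equation in \<open>u\<^sup>2\<close> is singular there.
\<close>

lemma cos_arcsin_ode:
  assumes u: "u \<in> arcsin_domain"
  shows "deriv (cos_arcsin s) u = - (2 * s * sin (2 * s * Arcsin u)) / cos (Arcsin u)"
    and "(1 - u\<^sup>2) * deriv (deriv (cos_arcsin s)) u - u * deriv (cos_arcsin s) u
           + 4 * s\<^sup>2 * cos_arcsin s u = 0"
proof -
  have nz: "cos (Arcsin u) \<noteq> 0" if "u \<in> arcsin_domain" for u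
    using that by (intro cos_Arcsin_nonzero) (auto simp: arcsin_domain_def power2_eq_1_iff)
  let ?D = "\<lambda>u. - (2 * s * sin (2 * s * Arcsin u)) / cos (Arcsin u)"
  have D: "deriv (cos_arcsin s) u = ?D u" if "u \<in> arcsin_domain" for u
    unfolding cos_arcsin_def using that
    by (intro DERIV_imp_deriv) (auto intro!: derivative_eq_intros simp: field_simps arcsin_domain_def)
  show 1: "deriv (cos_arcsin s) u = ?D u" by (rule D[OF u])
  have "eventually (\<lambda>u. u \<in> arcsin_domain) (nhds u)"
    using open_arcsin_domain u by (rule eventually_nhds_in_open)
  hence "deriv (deriv (cos_arcsin s)) u = deriv ?D u"
    by (intro deriv_cong_ev refl) (auto elim: eventually_mono simp: D)
  also have "\<dots> = - (4 * s\<^sup>2 * cos (2 * s * Arcsin u) + 2 * s * sin (2 * s * Arcsin u) * u / cos (Arcsin u))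
                    / (cos (Arcsin u))\<^sup>2"
    by (rule DERIV_imp_deriv)
       (use nz[OF u] u in \<open>auto intro!: derivative_eq_intros simp: field_simps power2_eq_square arcsin_domain_def\<close>)
  finally have 2: "deriv (deriv (cos_arcsin s)) u = \<dots>" .
  show "(1 - u\<^sup>2) * deriv (deriv (cos_arcsin s)) u - u * deriv (cos_arcsin s) u
           + 4 * s\<^sup>2 * cos_arcsin s u = 0"
    unfolding 1 2 cos_Arcsin_squared[symmetric] cos_arcsin_def using nz[OF u] by (simp add: field_simps)
qed

lemma fps_cos_arcsin_nth:
  fixes s :: complex
  defines "F \<equiv> fps_expansion (cos_arcsin s) 0"
  shows "fps_nth F (2 * n) = pochhammer (- s) n * pochhammer s n / (pochhammer (1/2) n * fact n)"
    and "fps_nth F (2 * n + 1) = 0"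
proof -
  have F: "cos_arcsin s has_fps_expansion F"
    unfolding F_def using open_arcsin_domain ball_subset_arcsin_domain
    by (intro has_fps_expansion_fps_expansion[of arcsin_domain] holomorphic_on_cos_arcsin) auto
  let ?E = "(1 - fps_X ^ 2) * fps_deriv (fps_deriv F) - fps_X * fps_deriv F + fps_const (4 * s\<^sup>2) * F"
  have "(\<lambda>u. (1 - u\<^sup>2) * deriv (deriv (cos_arcsin s)) u - u * deriv (cos_arcsin s) u
           + 4 * s\<^sup>2 * cos_arcsin s u) has_fps_expansion ?E"
    by (intro fps_expansion_intros F)
  moreover have "eventually (\<lambda>u::complex. u \<in> arcsin_domain) (nhds 0)"
    using ball_subset_arcsin_domain by (intro eventually_nhds_in_open open_arcsin_domain) auto
  hence "eventually (\<lambda>u. (1 - u\<^sup>2) * deriv (deriv (cos_arcsin s)) u - u * deriv (cos_arcsin s) u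
           + 4 * s\<^sup>2 * cos_arcsin s u = 0) (nhds 0)"
    by (rule eventually_mono) (rule cos_arcsin_ode)
  ultimately have "(\<lambda>u. 0) has_fps_expansion ?E"
    using has_fps_expansion_cong by fastforce
  hence E: "?E = 0"
    using fps_expansion_unique_complex has_fps_expansion_0 by blast
  \<comment> \<open>Coefficient extraction from the differential equation couples \<open>n\<close> and \<open>n + 2\<close> only.\<close>
  have rec: "of_nat ((n + 2) * (n + 1)) * fps_nth F (n + 2) = ((of_nat n)\<^sup>2 - 4 * s\<^sup>2) * fps_nth F n" for n
  proof -
    have "fps_nth ?E n = of_nat ((n + 2) * (n + 1)) * fps_nth F (n + 2) - ((of_nat n)\<^sup>2 - 4 * s\<^sup>2) * fps_nth F n"
    proof -
      consider "n = 0" | "n = 1" | m where "n = m + 2"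
        by (metis One_nat_def add_2_eq_Suc' not0_implies_Suc)
      thus ?thesis
        by cases (auto simp: left_diff_distrib fps_X_power_mult_nth fps_X_mult_nth algebra_simps power2_eq_square)
    qed
    thus ?thesis unfolding E by simp
  qed
  have F0: "fps_nth F 0 = 1"
    by (simp add: F_def fps_expansion_def cos_arcsin_def)
  have F1: "fps_nth F 1 = 0"
    using cos_arcsin_ode(1)[of 0 s] by (simp add: F_def fps_expansion_def arcsin_domain_def)
  show "fps_nth F (2 * n) = pochhammer (- s) n * pochhammer s n / (pochhammer (1/2) n * fact n)"
  proof (induction n)
    case (Suc n)
    have p: "pochhammer (1/2 :: complex) n \<noteq> 0" "pochhammer (1/2 :: complex) (Suc n) \<noteq> 0"
      by (auto simp: pochhammer_eq_0_iff dest!: arg_cong[where f = Re])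
    have nz: "of_nat ((2 * n + 2) * (2 * n + 1)) \<noteq> (0 :: complex)"
      by (simp only: of_nat_eq_0_iff) simp
    have "fps_nth F (2 * Suc n) = ((of_nat (2 * n))\<^sup>2 - 4 * s\<^sup>2) / of_nat ((2 * n + 2) * (2 * n + 1)) * fps_nth F (2 * n)"
      using rec[of "2 * n"] nz by (simp add: field_simps del: of_nat_mult of_nat_add)
    also have "((of_nat (2 * n))\<^sup>2 - 4 * s\<^sup>2) / of_nat ((2 * n + 2) * (2 * n + 1))
        = (of_nat n - s) * (of_nat n + s) / ((of_nat n + 1) * (of_nat n + 1/2))"
      using nz of_nat_eq_0_iff[of "Suc n", where 'a = complex] of_nat_eq_0_iff[of "Suc (2 * n)", where 'a = complex]
      by (simp add: divide_simps) (simp add: algebra_simps power2_eq_square)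
    finally show ?case unfolding Suc.IH using p 
      by (simp add: pochhammer_Suc field_simps)
  qed (simp add: F0)
  show "fps_nth F (2 * n + 1) = 0"
  proof (induction n)
    case (Suc n)
    have "of_nat ((2 * n + 1 + 2) * (2 * n + 1 + 1)) \<noteq> (0 :: complex)"
      by (simp only: of_nat_eq_0_iff) simp
    hence "fps_nth F (2 * n + 1 + 2) = 0"
      using rec[of "2 * n + 1"] Suc by (metis mult_eq_0_iff)
    thus ?case by simp
  qed (use F1 in simp)
qed

lemma hypergeo_term_sums_cos_arcsin:
  assumes w: "norm w < 1"
  shows "hypergeo_term [- s, s] [1/2] w sums cos_arcsin s (csqrt w)"
proof -
  let ?F = "fps_expansion (cos_arcsin s) 0"
  have "csqrt w \<in> ball 0 1" using w by (simp add: norm_csqrt)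
  from holomorphic_power_series[OF holomorphic_on_subset[OF holomorphic_on_cos_arcsin ball_subset_arcsin_domain] this]
  have "(\<lambda>n. fps_nth ?F n * csqrt w ^ n) sums cos_arcsin s (csqrt w)"
    by (simp add: fps_expansion_def)
  moreover have "fps_nth ?F n * csqrt w ^ n = 0" if "n \<notin> range (\<lambda>n. 2 * n)" for n
  proof -
    have "odd n" using that by (auto elim: evenE)
    thus ?thesis by (auto elim!: oddE simp: fps_cos_arcsin_nth(2)[simplified])
  qed
  ultimately have "(\<lambda>n. fps_nth ?F (2 * n) * csqrt w ^ (2 * n)) sums cos_arcsin s (csqrt w)"
    using sums_mono_reindex[of "\<lambda>n. 2 * n" "\<lambda>n. fps_nth ?F n * csqrt w ^ n"]
    by (simp add: strict_mono_def)
  thus ?thesis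
    unfolding fps_cos_arcsin_nth(1) power_mult power2_csqrt by (simp add: hypergeo_term_def[abs_def] mult_ac)
qed

lemma holomorphic_on_cos_arcsin_csqrt: "(\<lambda>w. cos_arcsin s (csqrt w)) holomorphic_on slit_plane"
proof (rule holomorphic_on_even_csqrt[OF holomorphic_on_cos_arcsin open_arcsin_domain open_slit_plane])
  show "cos_arcsin s (- u) = cos_arcsin s u" for u
    by (simp add: cos_arcsin_def Arcsin_minus)
  fix w assume w: "w \<in> slit_plane"
  define q where "q = csqrt w"
  show "csqrt w \<in> arcsin_domain"
    unfolding arcsin_domain_def q_def[symmetric]
  proof (intro CollectI impI, rule ccontr)
    assume im: "Im q = 0" and re: "\<not> \<bar>Re q\<bar> < 1"
    have "w = q\<^sup>2" by (simp add: q_def)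
    also have "q = complex_of_real (Re q)" using im by (simp add: complex_eq_iff)
    finally have "w = complex_of_real ((Re q)\<^sup>2)" by simp
    moreover have "(Re q)\<^sup>2 \<ge> 1" using re abs_square_less_1[of "Re q"] by linarith
    ultimately show False using w by (auto simp: slit_plane_def simp del: of_real_power)
  qed
qed

section \<open>Averaging over the circle\<close>

lemma holomorphic_on_integral_scaled:
  fixes r :: "real \<Rightarrow> complex"
  assumes g: "g holomorphic_on S" and S: "open S" and r: "continuous_on {a..b} r"
    and scale: "\<And>z x. z \<in> S \<Longrightarrow> x \<in> {a..b} \<Longrightarrow> z * r x \<in> S"
  shows "(\<lambda>z. integral {a..b} (\<lambda>x. g (z * r x))) holomorphic_on S"
proof -
  have "(\<lambda>z. integral {a..b} (\<lambda>x. g (z * r x))) field_differentiable (at z0)" if "z0 \<in> S" for z0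
  proof -
    from that S obtain e where e: "e > 0" "ball z0 e \<subseteq> S" unfolding open_contains_ball by blast
    have "(\<lambda>z. integral (cbox a b) (\<lambda>x. g (z * r x))) holomorphic_on ball z0 e"
    proof (rule leibniz_rule_holomorphic[where fx = "\<lambda>z x. deriv g (z * r x) * r x"])
      fix z x assume z: "z \<in> ball z0 e" and x: "x \<in> cbox a b"
      have "(g has_field_derivative deriv g (z * r x)) (at (z * r x))"
        using e z x scale by (intro holomorphic_derivI[OF g S]) auto
      thus "((\<lambda>z. g (z * r x)) has_field_derivative deriv g (z * r x) * r x) (at z within ball z0 e)"
        by (rule DERIV_chain2) (auto intro!: derivative_eq_intros)
    next
      fix z assume "z \<in> ball z0 e"
      hence "continuous_on (cbox a b) (\<lambda>x. g (z * r x))"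
        using e scale
        by (intro continuous_on_compose2[OF holomorphic_on_imp_continuous_on[OF g]] continuous_intros)
           (use r in auto)
      thus "(\<lambda>x. g (z * r x)) integrable_on cbox a b" by (rule integrable_continuous)
    next
      have r2: "continuous_on (ball z0 e \<times> cbox a b) (\<lambda>p. r (snd p))"
        by (intro continuous_on_compose2[OF r] continuous_intros) auto
      have "continuous_on (ball z0 e \<times> cbox a b) (\<lambda>p. deriv g (fst p * r (snd p)))"
        by (intro continuous_on_compose2[OF holomorphic_on_imp_continuous_on[OF holomorphic_deriv[OF g S]]]
            continuous_intros r2) (use e scale in auto)
      with r2 show "continuous_on (ball z0 e \<times> cbox a b) (\<lambda>(z, x). deriv g (z * r x) * r x)"
        unfolding case_prod_beta by (rule continuous_on_mult[rotated])
    qed auto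
    thus ?thesis using e by (auto intro: holomorphic_on_imp_differentiable_at)
  qed
  thus ?thesis by (auto simp: holomorphic_on_def intro: field_differentiable_at_within)
qed

text \<open>
  The Wallis recursion: differentiating \<open>sin\<^sup>2\<^sup>m\<^sup>+\<^sup>1 (\<pi> x) cos (\<pi> x)\<close>, which vanishes at both ends, relates
  consecutive even powers.
\<close>

lemma has_integral_sin_power_even:
  "((\<lambda>x. sin (pi * x) ^ (2 * m)) has_integral pochhammer (1/2) m / fact m) {0..1::real}"
proof (induction m)
  case 0
  show ?case using has_integral_const_real[of 1 0 1] by simp
next
  case (Suc m)
  let ?F = "\<lambda>x. sin (pi * x) ^ (2 * m + 1) * cos (pi * x) / pi"
  let ?f = "\<lambda>x. (2 * real m + 1) * sin (pi * x) ^ (2 * m) - (2 * real m + 2) * sin (pi * x) ^ (2 * Suc m)"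
  have "(?f has_integral ?F 1 - ?F 0) {0..1}"
  proof (rule fundamental_theorem_of_calculus)
    fix x :: real
    have "(?F has_real_derivative (2 * real m + 1) * sin (pi * x) ^ (2 * m) * (cos (pi * x))\<^sup>2
        - sin (pi * x) ^ (2 * Suc m)) (at x within {0..1})"
      by (rule derivative_eq_intros refl | simp)+ (simp add: field_simps power2_eq_square)
    also have "(2 * real m + 1) * sin (pi * x) ^ (2 * m) * (cos (pi * x))\<^sup>2 - sin (pi * x) ^ (2 * Suc m) = ?f x"
      unfolding cos_squared_eq by (simp add: algebra_simps power2_eq_square)
    finally show "(?F has_vector_derivative ?f x) (at x within {0..1})"
      by (simp add: has_real_derivative_iff_has_vector_derivative)
  qed simp
  from has_integral_diff[OF has_integral_mult_right[OF Suc.IH, of "2 * real m + 1"] this]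
  have "((\<lambda>x. (2 * real m + 2) * sin (pi * x) ^ (2 * Suc m)) has_integral
      (2 * real m + 1) * (pochhammer (1/2) m / fact m)) {0..1}" by simp
  from has_integral_mult_right[OF this, of "1 / (2 * real m + 2)"]
  have "((\<lambda>x. sin (pi * x) ^ (2 * Suc m)) has_integral
      1 / (2 * real m + 2) * ((2 * real m + 1) * (pochhammer (1/2) m / fact m))) {0..1}"
    by (simp add: add_nonneg_eq_0_iff)
  also have "1 / (2 * real m + 2) * ((2 * real m + 1) * (pochhammer (1/2) m / fact m))
      = pochhammer (1/2) (Suc m) / fact (Suc m)"
    by (simp add: pochhammer_Suc divide_simps) (simp add: algebra_simps)?
  finally show ?case .
qed

text \<open>
  The \<open>4 n\<close>-th moment of the sine, rewritten with the duplication formula; it accounts for the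
  parameters \<open>1/4, 3/4\<close> above and one \<open>1/2\<close> below in the hypergeometric series.
\<close>

lemma pochhammer_half_double:
  "pochhammer (1/2) (2 * n) / fact (2 * n)
     = pochhammer (1/4) n * pochhammer (3/4) n / (pochhammer (1/2) n * fact n :: complex)"
  using pochhammer_double[of "1/4 :: complex" n] by (simp add: fact_double)

definition hypergeo_integral :: "complex \<Rightarrow> complex \<Rightarrow> complex" where
  "hypergeo_integral s z = integral {0..1} (\<lambda>x. cos_arcsin s (csqrt (z * complex_of_real (sin (pi * x) ^ 4))))"

lemma holomorphic_on_hypergeo_integral: "hypergeo_integral s holomorphic_on slit_plane"
  unfolding hypergeo_integral_def
proof (rule holomorphic_on_integral_scaled[OF holomorphic_on_cos_arcsin_csqrt open_slit_plane])
  fix z and x :: real assume z: "z \<in> slit_plane"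
  let ?r = "sin (pi * x) ^ 4"
  have r: "0 \<le> ?r" "?r \<le> 1" using power_le_one[of "\<bar>sin (pi * x)\<bar>" 4] by simp_all
  show "z * complex_of_real ?r \<in> slit_plane"
  proof (rule ccontr)
    assume "z * complex_of_real ?r \<notin> slit_plane"
    then obtain y where y: "y \<ge> 1" "z * complex_of_real ?r = complex_of_real y"
      by (auto simp: slit_plane_def)
    hence "?r \<noteq> 0" by (intro notI) simp
    with r have r0: "?r > 0" by linarith
    hence "z = complex_of_real (y / ?r)" using y(2) by (simp add: field_simps)
    moreover have "y / ?r \<ge> 1" using y r r0 by (simp add: le_divide_eq)
    ultimately have "z \<in> complex_of_real ` {1..}" by blast
    thus False using z by (simp add: slit_plane_def)
  qed
qed (intro continuous_intros)

text \<open>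
  On a disc of radius \<open>\<rho> < 1\<close> the Gauss series converges absolutely and \<open>\<bar>sin\<^sup>4 (\<pi> x)\<bar> \<le> 1\<close>, so the Weierstrass
  test permits integration term by term.
\<close>

lemma hypergeo_term_sums_integral:
  assumes z: "norm z < 1"
  shows "hypergeo_term [1/4, 3/4, - s, s] [1/2, 1/2, 1] z sums hypergeo_integral s z"
proof -
  define c where "c n = pochhammer (- s) n * pochhammer s n / (pochhammer (1/2) n * fact n)" for n
  have sums: "(\<lambda>n. c n * w ^ n) sums cos_arcsin s (csqrt w)" if "norm w < 1" for w
    using hypergeo_term_sums_cos_arcsin[OF that] by (simp add: c_def hypergeo_term_def[abs_def] mult_ac)
  obtain \<rho> where \<rho>: "norm z < \<rho>" "\<rho> < 1" using z dense by blast
  hence \<rho>0: "\<rho> > 0" using norm_ge_zero[of z] by linarith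
  have summable: "summable (\<lambda>n. norm (c n * z ^ n))"
    using powser_insidea[OF sums_summable[OF sums[of "complex_of_real \<rho>"]]] \<rho> \<rho>0 by simp
  let ?f = "\<lambda>n x. c n * (z * complex_of_real (sin (pi * x) ^ 4)) ^ n"
  have bound: "norm (sin (pi * x) ^ 4) \<le> 1" for x
    using power_le_one[of "\<bar>sin (pi * x)\<bar>" 4] by (simp add: norm_power)
  have "norm (?f n x) \<le> norm (c n * z ^ n)" for n x
  proof -
    have "norm (?f n x) = norm (c n * z ^ n) * norm (sin (pi * x) ^ 4) ^ n"
      by (simp add: norm_mult norm_power power_mult_distrib)
    also have "\<dots> \<le> norm (c n * z ^ n) * 1"
      by (intro mult_left_mono power_le_one bound) auto
    finally show ?thesis by simp
  qed
  from Weierstrass_m_test[OF this summable]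
  have "uniform_limit {0..1} (\<lambda>n x. \<Sum>i<n. ?f i x) (\<lambda>x. \<Sum>i. ?f i x) sequentially" .
  moreover have "(\<Sum>i. ?f i x) = cos_arcsin s (csqrt (z * complex_of_real (sin (pi * x) ^ 4)))" for x
  proof (rule sums_unique[symmetric], rule sums)
    have "norm (z * complex_of_real (sin (pi * x) ^ 4)) = norm z * norm (sin (pi * x) ^ 4)"
      by (simp add: norm_mult norm_power)
    also have "\<dots> \<le> norm z * 1" by (intro mult_left_mono bound) auto
    finally show "norm (z * complex_of_real (sin (pi * x) ^ 4)) < 1" using z by simp
  qed
  ultimately have lim: "uniform_limit {0..1} (\<lambda>n x. \<Sum>i<n. ?f i x)
      (\<lambda>x. cos_arcsin s (csqrt (z * complex_of_real (sin (pi * x) ^ 4)))) sequentially" by simp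
  have "continuous_on {0..1} (\<lambda>x. \<Sum>i<n. ?f i x)" for n
    by (intro continuous_intros)
  from uniform_limit_integral[OF lim this] obtain I J where IJ:
    "\<And>n. ((\<lambda>x. \<Sum>i<n. ?f i x) has_integral I n) {0..1}"
    "((\<lambda>x. cos_arcsin s (csqrt (z * complex_of_real (sin (pi * x) ^ 4)))) has_integral J) {0..1}"
    "I \<longlonglongrightarrow> J" by auto
  have term_integral: "(?f n has_integral hypergeo_term [1/4, 3/4, - s, s] [1/2, 1/2, 1] z n) {0..1}" for n
  proof -
    have "((\<lambda>x. complex_of_real (sin (pi * x) ^ (2 * (2 * n)))) has_integral
        complex_of_real (pochhammer (1/2) (2 * n) / fact (2 * n))) {0..1}"
      by (intro has_integral_of_real has_integral_sin_power_even)
    from has_integral_mult_right[OF this, of "c n * z ^ n"]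
    have "((\<lambda>x. c n * z ^ n * complex_of_real (sin (pi * x) ^ (2 * (2 * n)))) has_integral
        c n * z ^ n * (pochhammer (1/2) (2 * n) / fact (2 * n))) {0..1}" 
      by (simp flip: pochhammer_of_real)
    also have "(\<lambda>x. c n * z ^ n * complex_of_real (sin (pi * x) ^ (2 * (2 * n)))) = ?f n"
      by (simp add: fun_eq_iff power_mult_distrib flip: power_mult)
    also have "c n * z ^ n * (pochhammer (1/2) (2 * n) / fact (2 * n)) 
        = hypergeo_term [1/4, 3/4, - s, s] [1/2, 1/2, 1] z n"
      unfolding pochhammer_half_double by (simp add: c_def hypergeo_term_def pochhammer_fact[symmetric] mult_ac)
    finally show ?thesis .
  qed
  have "I = (\<lambda>n. \<Sum>i<n. hypergeo_term [1/4, 3/4, - s, s] [1/2, 1/2, 1] z i)"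
    by (intro ext has_integral_unique[OF IJ(1)] has_integral_sum term_integral) simp
  moreover have "J = hypergeo_integral s z"
    using IJ(2) unfolding hypergeo_integral_def by (simp add: integral_unique)
  ultimately show ?thesis using IJ(3) by (simp add: sums_def)
qed

section \<open>The value at -4 and the theorem\<close>

lemma Arcsin_i_times: "Arcsin (\<i> * complex_of_real x) = \<i> * complex_of_real (arsinh x)"
proof (rule Arcsin_unique)
  have "sin (\<i> * complex_of_real (arsinh x)) = \<i> * sinh (complex_of_real (arsinh x))"
    by (simp add: sinh_conv_sin)
  also have "sinh (complex_of_real (arsinh x)) = complex_of_real x"
    using arg_cong[OF sinh_arsinh_real[of x], of complex_of_real]
    by (simp add: sinh_field_def exp_of_real[symmetric])
  finally show "sin (\<i> * complex_of_real (arsinh x)) = \<i> * complex_of_real x" .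
qed auto

lemma hypergeo_eq_zeta_integral:
  "complex_of_real pi * hypergeo [1/4, 3/4, - s, s] [1/2, 1/2, 1] (- 4) = complex_of_real (pi / 2) * zeta_integral s"
proof -
  have "- 4 \<in> slit_plane" by (auto simp: slit_plane_def complex_eq_iff)
  hence "hypergeo [1/4, 3/4, - s, s] [1/2, 1/2, 1] (- 4) = hypergeo_integral s (- 4)"
    by (intro hypergeo_eqI holomorphic_on_hypergeo_integral hypergeo_term_sums_integral)
  also have "\<dots> = integral {0..1} (\<lambda>x. zeta_kernel s (sin (pi * x) ^ 2) / 2)"
    unfolding hypergeo_integral_def
  proof (rule integral_cong)
    fix x :: real
    let ?v = "2 * sin (pi * x) ^ 2"
    have "csqrt (- 4 * complex_of_real (sin (pi * x) ^ 4)) = csqrt (- complex_of_real (?v\<^sup>2))"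
      by (simp add: power_mult_distrib flip: power_mult)
    also have "\<dots> = \<i> * csqrt (complex_of_real (?v\<^sup>2))"
      by (rule csqrt_minus) simp
    also have "csqrt (complex_of_real (?v\<^sup>2)) = complex_of_real (sqrt (?v\<^sup>2))"
      by (subst csqrt_of_real_nonneg) auto
    also have "sqrt (?v\<^sup>2) = ?v" by (rule real_sqrt_unique) auto
    finally have "cos_arcsin s (csqrt (- 4 * complex_of_real (sin (pi * x) ^ 4)))
        = cos (\<i> * (2 * s * complex_of_real (arsinh ?v)))"
      unfolding cos_arcsin_def by (simp only: Arcsin_i_times mult_ac)
    thus "cos_arcsin s (csqrt (- 4 * complex_of_real (sin (pi * x) ^ 4))) = zeta_kernel s (sin (pi * x) ^ 2) / 2"
      by (simp add: zeta_kernel_def cosh_conv_cos)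
  qed
  also have "\<dots> = zeta_integral s / 2"
    by (simp add: zeta_integral_def)
  finally show ?thesis by simp
qed

theorem theorem3:
  shows
    "(\<forall>s. rescaled_limiting_zeta (2 * s) =
        complex_of_real pi * hypergeo [1/4, 3/4, -s, s] [1/2, 1/2, 1] (-4)) \<and>
     (\<forall>t. ((\<lambda>y. cos (t * complex_of_real y) *
              complex_of_real (sqrt (cosh y * coth y / (2 - sinh y))))
        has_integral rescaled_limiting_zeta (\<i> * t)) {0..ln (2 + sqrt 5)}) \<and>
     (\<forall>t. ((\<lambda>x. 2 * cos (t * complex_of_real
              (ln ((sqrt (4 * sin (pi * x) ^ 4 + 1) + 2 * sin (pi * x) ^ 2) ^ 2))))
        has_integral limiting_zeta (\<i> * t)) {0..1}) \<and>
     (\<forall>t. ((\<lambda>v. 2 * cos (2 * t * complex_of_real (ln (sqrt (4 * v ^ 2 + 1) + 2 * v))) /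
              complex_of_real (pi * sqrt (1 - v) * sqrt v))
        has_integral limiting_zeta (\<i> * t)) {0..1}) \<and>
     (\<forall>s. let a = 2 + sqrt 5 in
        ((\<lambda>z. (complex_of_real z ^ 2 + 1) * complex_of_real z powr (-1 - s) *
               (1 + complex_of_real z powr (2 * s)) /
              (2 * complex_of_real (sqrt ((1 + z) * (1 - z) * (z - a) * (z + 1 / a)))))
        has_integral rescaled_limiting_zeta s) {1..a})"
proof -
  have rescaled: "rescaled_limiting_zeta s = complex_of_real (pi / 2) * zeta_integral (s / 2)" for s
    by (simp add: rescaled_limiting_zeta_def limiting_zeta_eq_integral)
  show ?thesis
    unfolding rescaled limiting_zeta_eq_integral Let_def
    by (intro conjI allI zeta_integral_cos_transform zeta_integral_sin
        zeta_integral_arcsine zeta_integral_abelian) (simp add: hypergeo_eq_zeta_integral)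
qed

end
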